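(* Let $\mathbb F$ be an algebraically closed field and let $q\in\mathbb F$ be nonzero and not a root of unity. Let $V$ be an evaluation module for $\boxtimes_q$. For $X\in{\rm End}(V)$ the following are equivalent: (i) $X$ is an exchanger for $V$; (ii) for all $i\in\mathbb Z_4$, $X$ sends the flag $[i]$ for $V$ to the flag $[i+2]$ for $V$; (iii) for all distinct $i,j\in\mathbb Z_4$, $X$ sends the decomposition $[i,j]$ of $V$ to the decomposition $[i+2,j+2]$ of $V$.
   Context: Algebras are associative with 1. $[n]_q=(q^n-q^{-n})/(q-q^{-1})$ and $\mathbb Z_4=\mathbb Z/4\mathbb Z$. The $q$-tetrahedron algebra $\boxtimes_q$ is the $\mathbb F$-algebra with generators (called the standard generators) $\{x_{ij}\mid i,j\in\mathbb Z_4,\ j-i=1\text{ or }j-i=2\}$ and relations: (i) $x_{ij}x_{ji}=1$ if $j-i=2$; (ii) $\frac{qx_{ij}x_{jk}-q^{-1}x_{jk}x_{ij}}{q-q^{-1}}=1$ if $(j-i,k-j)$ is one of $(1,1),(1,2),(2,1)$; (iii) $x_{ij}^3x_{k\ell}-[3]_qx_{ij}^2x_{k\ell}x_{ij}+[3]_qx_{ij}x_{k\ell}x_{ij}^2-x_{k\ell}x_{ij}^3=0$ if $j-i=k-j=\ell-k=1$. Known fact: on a finite-dimensional irreducible $\boxtimes_q$-module $V$ there are $d\in\mathbb N$ (the diameter) and $\varepsilon\in\{1,-1\}$ (the type) such that each standard generator is diagonalizable with set of distinct eigenvalues $\{\varepsilon q^{d-2n}\mid 0\le n\le d\}$. Let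 $V$ have type 1. For distinct $i,j\in\mathbb Z_4$ the decomposition $[i,j]$ of $V$ is the sequence of subspaces $\{V_n\}_{n=0}^d$ (with $V=\bigoplus_n V_n$) such that: if $j-i\in\{1,2\}$, $V_n$ is the eigenspace of $x_{ij}$ with eigenvalue $q^{d-2n}$; if $j-i=3$, $[i,j]$ is the inversion (reversed sequence) of $[j,i]$. The shape $(\dim V_n)_{n=0}^d$ does not depend on $i,j$. For $i\in\mathbb Z_4$ the flag $[i]$ on $V$ has $n$th component $V_0+\cdots+V_n$, where $\{V_n\}$ is the decomposition $[i,j]$; this is known not to depend on $j\ne i$. The trivial $\boxtimes_q$-module is the one-dimensional module on which every standard generator acts as the identity. An evaluation module for $\boxtimes_q$ is a nontrivial finite-dimensional irreducible $\boxtimes_q$-module of type 1 and shape $(1,1,\dots,1)$ (so $d\ge1$, $\dim V=d+1$). An exchanger for $V$ is an invertible $X\in{\rm End}(V)$ such that $Xx_{ij}X^{-1}=x_{i+2,j+2}$ holds on $V$ for each standard generator $x_{ij}$. "$X$ sends a flag (or decomposition) $\{U_n\}_{n=0}^d$ to $\{U'_n\}_{n=0}^d$" means $XU_n=U'_n$ for $0\le n\le d$. *)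

theory Defs
  imports "HOL-Library.Numeral_Type" "HOL-Computational_Algebra.Polynomial"
begin

text \<open>
  Conventions. The index set of integers modulo 4 is the type \<open>4\<close> of \<open>Numeral_Type\<close>, whose arithmetic
  is modulo 4. The vector space \<open>V\<close> is the whole type \<open>'v\<close>, with scalar multiplication \<open>scale\<close>.
  The \<open>q\<close>-tetrahedron algebra is given by generators and relations, so a module structure on \<open>V\<close>
  is the same as a family \<open>x\<close> of endomorphisms satisfying the relations; \<open>x i j\<close> is the action of the
  standard generator with indices \<open>i\<close>, \<open>j\<close> and is meaningful only if \<open>std_gen i j\<close>.
\<close>

definition std_gen :: "4 \<Rightarrow> 4 \<Rightarrow> bool" where
  "std_gen i j \<longleftrightarrow> j - i = 1 \<or> j - i = 2"

definition q_int :: "'f::field \<Rightarrow> nat \<Rightarrow> 'f" where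
  "q_int q n = (q ^ n - inverse q ^ n) / (q - inverse q)"

definition tet_module ::
  "('f::field \<Rightarrow> 'v::ab_group_add \<Rightarrow> 'v) \<Rightarrow> 'f \<Rightarrow> (4 \<Rightarrow> 4 \<Rightarrow> 'v \<Rightarrow> 'v) \<Rightarrow> bool" where
  "tet_module scale q x \<longleftrightarrow>
     vector_space scale \<and>
     (\<forall>i j. std_gen i j \<longrightarrow> Vector_Spaces.linear scale scale (x i j)) \<and>
     (\<forall>i j. j - i = 2 \<longrightarrow> (\<forall>v. x i j (x j i v) = v)) \<and>
     (\<forall>i j k. (j - i, k - j) \<in> {(1, 1), (1, 2), (2, 1)} \<longrightarrow>
        (\<forall>v. scale (1 / (q - inverse q))
               (scale q (x i j (x j k v)) - scale (inverse q) (x j k (x i j v))) = v)) \<and>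
     (\<forall>i j k l. j - i = 1 \<and> k - j = 1 \<and> l - k = 1 \<longrightarrow>
        (\<forall>v. (x i j ^^ 3) (x k l v)
             - scale (q_int q 3) ((x i j ^^ 2) (x k l (x i j v)))
             + scale (q_int q 3) (x i j (x k l ((x i j ^^ 2) v)))
             - x k l ((x i j ^^ 3) v) = 0))"

definition finite_dim :: "('f::field \<Rightarrow> 'v::ab_group_add \<Rightarrow> 'v) \<Rightarrow> bool" where
  "finite_dim scale \<longleftrightarrow> (\<exists>B. finite B \<and> module.span scale B = UNIV)"

definition tet_irreducible ::
  "('f::field \<Rightarrow> 'v::ab_group_add \<Rightarrow> 'v) \<Rightarrow> (4 \<Rightarrow> 4 \<Rightarrow> 'v \<Rightarrow> 'v) \<Rightarrow> bool" where
  "tet_irreducible scale x \<longleftrightarrow>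
     (UNIV :: 'v set) \<noteq> {0} \<and>
     (\<forall>W. module.subspace scale W \<and> (\<forall>i j. std_gen i j \<longrightarrow> x i j ` W \<subseteq> W)
            \<longrightarrow> W = {0} \<or> W = UNIV)"

definition eigenspace ::
  "('f::field \<Rightarrow> 'v::ab_group_add \<Rightarrow> 'v) \<Rightarrow> ('v \<Rightarrow> 'v) \<Rightarrow> 'f \<Rightarrow> 'v set" where
  "eigenspace scale T c = {v. T v = scale c v}"

definition eigenvalues ::
  "('f::field \<Rightarrow> 'v::ab_group_add \<Rightarrow> 'v) \<Rightarrow> ('v \<Rightarrow> 'v) \<Rightarrow> 'f set" where
  "eigenvalues scale T = {c. \<exists>v. v \<noteq> 0 \<and> T v = scale c v}"

definition diagonalizable ::
  "('f::field \<Rightarrow> 'v::ab_group_add \<Rightarrow> 'v) \<Rightarrow> ('v \<Rightarrow> 'v) \<Rightarrow> bool" where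
  "diagonalizable scale T \<longleftrightarrow>
     (\<exists>B. \<not> module.dependent scale B \<and> module.span scale B = UNIV \<and>
          (\<forall>b\<in>B. \<exists>c. T b = scale c b))"

definition has_diameter_type ::
  "('f::field \<Rightarrow> 'v::ab_group_add \<Rightarrow> 'v) \<Rightarrow> 'f \<Rightarrow> (4 \<Rightarrow> 4 \<Rightarrow> 'v \<Rightarrow> 'v) \<Rightarrow> nat \<Rightarrow> 'f \<Rightarrow> bool" where
  "has_diameter_type scale q x d \<epsilon> \<longleftrightarrow>
     \<epsilon> \<in> {1, -1} \<and>
     (\<forall>i j. std_gen i j \<longrightarrow>
        diagonalizable scale (x i j) \<and>
        eigenvalues scale (x i j) = {\<epsilon> * q powi (int d - 2 * int n) | n. n \<le> d})"

text \<open>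
  The \<open>n\<close>th component of the decomposition \<open>[i,j]\<close> for a module of type 1 and diameter \<open>d\<close>,
  to be used for \<open>i \<noteq> j\<close> and \<open>n \<le> d\<close> only.
\<close>

definition tet_decomp ::
  "('f::field \<Rightarrow> 'v::ab_group_add \<Rightarrow> 'v) \<Rightarrow> 'f \<Rightarrow> (4 \<Rightarrow> 4 \<Rightarrow> 'v \<Rightarrow> 'v) \<Rightarrow> nat \<Rightarrow>
     4 \<Rightarrow> 4 \<Rightarrow> nat \<Rightarrow> 'v set" where
  "tet_decomp scale q x d i j n =
     (if std_gen i j then eigenspace scale (x i j) (q powi (int d - 2 * int n))
      else eigenspace scale (x j i) (q powi (int d - 2 * int (d - n))))"

text \<open>
  The \<open>n\<close>th component of the flag \<open>[i]\<close>: the sum of the first \<open>n + 1\<close> components of \<open>[i,j]\<close>.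
  As this does not depend on the choice of \<open>j \<noteq> i\<close>, the choice \<open>j = i + 1\<close> is made.
\<close>

definition tet_flag ::
  "('f::field \<Rightarrow> 'v::ab_group_add \<Rightarrow> 'v) \<Rightarrow> 'f \<Rightarrow> (4 \<Rightarrow> 4 \<Rightarrow> 'v \<Rightarrow> 'v) \<Rightarrow> nat \<Rightarrow>
     4 \<Rightarrow> nat \<Rightarrow> 'v set" where
  "tet_flag scale q x d i n =
     {\<Sum>m\<le>n. v m | v. \<forall>m\<le>n. v m \<in> tet_decomp scale q x d i (i + 1) m}"

definition tet_trivial ::
  "('f::field \<Rightarrow> 'v::ab_group_add \<Rightarrow> 'v) \<Rightarrow> (4 \<Rightarrow> 4 \<Rightarrow> 'v \<Rightarrow> 'v) \<Rightarrow> bool" where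
  "tet_trivial scale x \<longleftrightarrow>
     vector_space.dim scale (UNIV :: 'v set) = 1 \<and>
     (\<forall>i j. std_gen i j \<longrightarrow> (\<forall>v. x i j v = v))"

text \<open>Evaluation modules of diameter \<open>d\<close>; the last conjunct says that the shape is \<open>(1,1,\<dots>,1)\<close>.\<close>

definition evaluation_module ::
  "('f::field \<Rightarrow> 'v::ab_group_add \<Rightarrow> 'v) \<Rightarrow> 'f \<Rightarrow> (4 \<Rightarrow> 4 \<Rightarrow> 'v \<Rightarrow> 'v) \<Rightarrow> nat \<Rightarrow> bool" where
  "evaluation_module scale q x d \<longleftrightarrow>
     tet_module scale q x \<and> finite_dim scale \<and> tet_irreducible scale x \<and>
     \<not> tet_trivial scale x \<and> has_diameter_type scale q x d 1 \<and>
     (\<forall>i j. i \<noteq> j \<longrightarrow>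
        (\<forall>n\<le>d. vector_space.dim scale (tet_decomp scale q x d i j n) = 1))"

definition exchanger ::
  "('f::field \<Rightarrow> 'v::ab_group_add \<Rightarrow> 'v) \<Rightarrow> (4 \<Rightarrow> 4 \<Rightarrow> 'v \<Rightarrow> 'v) \<Rightarrow> ('v \<Rightarrow> 'v) \<Rightarrow> bool" where
  "exchanger scale x X \<longleftrightarrow>
     Vector_Spaces.linear scale scale X \<and> bij X \<and>
     (\<forall>i j. std_gen i j \<longrightarrow> X \<circ> x i j \<circ> inv X = x (i + 2) (j + 2))"

definition sends :: "('v \<Rightarrow> 'v) \<Rightarrow> nat \<Rightarrow> (nat \<Rightarrow> 'v set) \<Rightarrow> (nat \<Rightarrow> 'v set) \<Rightarrow> bool" where
  "sends X d U U' \<longleftrightarrow> (\<forall>n\<le>d. X ` U n = U' n)"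

end

theory Submission
  imports Defs
begin

text \<open>
  Everything is governed by one fact about flags: the decomposition \<open>[i,j]\<close> can be recovered from
  flags, because its \<open>n\<close>th component is the intersection of the \<open>n\<close>th component of the flag \<open>[i]\<close>
  with the \<open>(d - n)\<close>th component of the flag \<open>[j]\<close> (\<open>decomp_eq_flag_inter\<close>). A bijection that
  moves the flags correctly therefore moves the decompositions correctly. Since the components
  are the eigenspaces of the standard generators, and the eigenvalue sequence is the same for every
  generator, a map that moves the decompositions correctly intertwines \<open>x i j\<close> with
  \<open>x (i + 2) (j + 2)\<close>, so it is an exchanger; an exchanger visibly moves eigenspaces to eigenspaces;
  and flags are sums of components of decompositions. This closes the circle of implications. The
  map is bijective in each case: the components, or the top component of a flag, sum to the whole
  space, so the map is onto, and \<open>V\<close> is finite-dimensional.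

  The recovery of \<open>[i,j]\<close> requires that the three decompositions \<open>[j,i]\<close> starting at \<open>j\<close>
  all induce the same flag (\<open>component_sum_decomp_eq_flag\<close>). Two of them are compared
  through the \<open>q\<close>-Weyl relation \<open>q A B - q\<^sup>-\<^sup>1 B A = q - q\<^sup>-\<^sup>1\<close> that links the generators
  \<open>A = x i j\<close> and \<open>B = x j k\<close>. If \<open>A v = c v\<close> then this relation says that \<open>B v - c\<^sup>-\<^sup>1 v\<close> lies
  in the eigenspace of \<open>A\<close> for \<open>q\<^sup>-\<^sup>2 c\<close>, the next one in the eigenvalue sequence
  (\<open>q_weyl_shifts_eigenvector\<close>). Hence the partial sums of the eigenspaces of \<open>A\<close> are
  invariant under \<open>B\<close>, which acts on them in a triangular way, and so they lie in the partial sums of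
  the corresponding eigenspaces of \<open>B\<close> (\<open>q_weyl_partial_sums_subset\<close>). The relation is unchanged
  if \<open>A\<close>, \<open>B\<close> are swapped and \<open>q\<close> is inverted, which gives the reverse inclusion.
\<close>

section \<open>Sums of components of a sequence of subspaces\<close>

definition component_sum :: "(nat \<Rightarrow> 'v::ab_group_add set) \<Rightarrow> nat set \<Rightarrow> 'v set" where
  "component_sum D S = {\<Sum>m\<in>S. v m | v. \<forall>m\<in>S. v m \<in> D m}"

lemma component_sumI: "(\<And>m. m \<in> S \<Longrightarrow> v m \<in> D m) \<Longrightarrow> (\<Sum>m\<in>S. v m) \<in> component_sum D S"
  unfolding component_sum_def by blast

lemma component_sumE:
  assumes "v \<in> component_sum D S"
  obtains u where "v = (\<Sum>m\<in>S. u m)" "\<And>m. m \<in> S \<Longrightarrow> u m \<in> D m"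
  using assms unfolding component_sum_def by blast

lemma component_sum_cong:
  assumes "\<And>m. m \<in> S \<Longrightarrow> D m = D' m"
  shows "component_sum D S = component_sum D' S"
  unfolding component_sum_def using assms by auto

lemma component_sum_empty [simp]: "component_sum D {} = {0}"
  by (simp add: component_sum_def)

lemma component_sum_singleton [simp]: "component_sum D {m} = D m"
  unfolding component_sum_def by auto

lemma component_sum_reindex:
  assumes inj: "inj_on f S"
  shows "component_sum (\<lambda>m. D (f m)) S = component_sum D (f ` S)"
proof
  show "component_sum (\<lambda>m. D (f m)) S \<subseteq> component_sum D (f ` S)"
  proof
    fix v assume "v \<in> component_sum (\<lambda>m. D (f m)) S"
    then obtain u where u: "v = (\<Sum>m\<in>S. u m)" "\<And>m. m \<in> S \<Longrightarrow> u m \<in> D (f m)"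
      by (elim component_sumE) blast
    have "v = (\<Sum>k\<in>f ` S. u (the_inv_into S f k))"
      using u(1) inj by (simp add: sum.reindex the_inv_into_f_f cong: sum.cong)
    also have "\<dots> \<in> component_sum D (f ` S)"
      using u(2) inj by (intro component_sumI) (auto simp: the_inv_into_f_f)
    finally show "v \<in> component_sum D (f ` S)" .
  qed
  show "component_sum D (f ` S) \<subseteq> component_sum (\<lambda>m. D (f m)) S"
  proof
    fix v assume "v \<in> component_sum D (f ` S)"
    then obtain u where u: "v = (\<Sum>k\<in>f ` S. u k)" "\<And>k. k \<in> f ` S \<Longrightarrow> u k \<in> D k"
      by (elim component_sumE) blast
    have "v = (\<Sum>m\<in>S. u (f m))"
      using u(1) inj by (simp add: sum.reindex)
    also have "\<dots> \<in> component_sum (\<lambda>m. D (f m)) S"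
      using u(2) by (intro component_sumI) auto
    finally show "v \<in> component_sum (\<lambda>m. D (f m)) S" .
  qed
qed

lemma component_sum_mono:
  assumes fin: "finite S'" and sub: "S \<subseteq> S'" and zero: "\<And>m. m \<in> S' \<Longrightarrow> 0 \<in> D m"
  shows "component_sum D S \<subseteq> component_sum D S'"
proof
  fix v assume "v \<in> component_sum D S"
  then obtain u where u: "v = (\<Sum>m\<in>S. u m)" "\<And>m. m \<in> S \<Longrightarrow> u m \<in> D m"
    by (elim component_sumE) blast
  have "v = (\<Sum>m\<in>S'. if m \<in> S then u m else 0)"
    using u(1) sub by (simp add: sum.inter_restrict[OF fin, symmetric] Int_absorb1)
  also have "\<dots> \<in> component_sum D S'"
    using u(2) zero by (intro component_sumI) auto
  finally show "v \<in> component_sum D S'" .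
qed

context vector_space
begin

lemma linear_image_component_sum:
  assumes "Vector_Spaces.linear scale scale X"
  shows "X ` component_sum D S = component_sum (\<lambda>m. X ` D m) S"
proof -
  interpret X: Vector_Spaces.linear scale scale X by fact
  show ?thesis
  proof
    show "X ` component_sum D S \<subseteq> component_sum (\<lambda>m. X ` D m) S"
      by (auto elim!: component_sumE simp: X.sum intro!: component_sumI)
    show "component_sum (\<lambda>m. X ` D m) S \<subseteq> X ` component_sum D S"
    proof
      fix v assume "v \<in> component_sum (\<lambda>m. X ` D m) S"
      then obtain u where u: "v = (\<Sum>m\<in>S. u m)" "\<And>m. m \<in> S \<Longrightarrow> u m \<in> X ` D m"
        by (elim component_sumE) blast
      then obtain w where w: "\<And>m. m \<in> S \<Longrightarrow> w m \<in> D m \<and> u m = X (w m)"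
        unfolding image_iff Bex_def by metis
      have "v = X (\<Sum>m\<in>S. w m)"
        using u(1) w by (simp add: X.sum)
      then show "v \<in> X ` component_sum D S"
        using w by (auto intro!: imageI component_sumI)
    qed
  qed
qed

lemma subspace_component_sum:
  assumes "\<And>m. m \<in> S \<Longrightarrow> subspace (D m)"
  shows "subspace (component_sum D S)"
proof (rule subspaceI)
  show "0 \<in> component_sum D S"
    using component_sumI[of S "\<lambda>_. 0" D] assms subspace_0 by simp
next
  fix v w assume "v \<in> component_sum D S" "w \<in> component_sum D S"
  then obtain u u' where "v = (\<Sum>m\<in>S. u m)" "w = (\<Sum>m\<in>S. u' m)"
    "\<And>m. m \<in> S \<Longrightarrow> u m \<in> D m" "\<And>m. m \<in> S \<Longrightarrow> u' m \<in> D m"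
    by (elim component_sumE) blast
  then show "v + w \<in> component_sum D S"
    using assms by (auto simp: sum.distrib[symmetric] intro!: component_sumI subspace_add)
next
  fix c v assume "v \<in> component_sum D S"
  then obtain u where "v = (\<Sum>m\<in>S. u m)" "\<And>m. m \<in> S \<Longrightarrow> u m \<in> D m"
    by (elim component_sumE) blast
  then show "scale c v \<in> component_sum D S"
    using assms by (auto simp: scale_sum_right intro!: component_sumI subspace_scale)
qed

section \<open>Sums of eigenspaces\<close>

lemma subspace_eigenspace:
  assumes "Vector_Spaces.linear scale scale T"
  shows "subspace (eigenspace scale T c)"
proof -
  interpret T: Vector_Spaces.linear scale scale T by fact
  show ?thesis
    by (rule subspaceI) (auto simp: eigenspace_def T.add T.scale T.zero scale_right_distrib mult.commute)
qed

lemma eigenvectors_independent: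
  assumes lin: "Vector_Spaces.linear scale scale T"
    and "finite S" "inj_on \<theta> S"
    and "\<And>m. m \<in> S \<Longrightarrow> v m \<in> eigenspace scale T (\<theta> m)"
    and "(\<Sum>m\<in>S. v m) = 0" "m \<in> S"
  shows "v m = 0"
  using assms(2-)
proof (induction S arbitrary: v m rule: finite_induct)
  case empty
  then show ?case by simp
next
  case (insert a S)
  interpret T: Vector_Spaces.linear scale scale T by fact
  have eig: "T (v m) = scale (\<theta> m) (v m)" if "m \<in> insert a S" for m
    using insert.prems(2)[OF that] by (simp add: eigenspace_def)
  have *: "v a + (\<Sum>m\<in>S. v m) = 0"
    using insert by simp
  (* The operator T - theta a removes the a-th summand and rescales the others by nonzero factors. *)
  have "(\<Sum>m\<in>S. scale (\<theta> m - \<theta> a) (v m))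
          = T (v a + (\<Sum>m\<in>S. v m)) - scale (\<theta> a) (v a + (\<Sum>m\<in>S. v m))"
    by (simp add: T.add T.sum eig scale_right_distrib scale_sum_right scale_left_diff_distrib
        sum_subtractf)
  also have "\<dots> = 0"
    by (simp only: * T.zero scale_zero_right diff_0_right)
  finally have sum0: "(\<Sum>m\<in>S. scale (\<theta> m - \<theta> a) (v m)) = 0" .
  have zero: "v m = 0" if "m \<in> S" for m
  proof -
    have "scale (\<theta> m - \<theta> a) (v m) = 0"
    proof (rule insert.IH[OF _ _ sum0 that])
      show "inj_on \<theta> S"
        using insert.prems(1) by simp
      show "scale (\<theta> k - \<theta> a) (v k) \<in> eigenspace scale T (\<theta> k)" if "k \<in> S" for k
        using eig that by (simp add: eigenspace_def T.scale mult.commute)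
    qed
    moreover have "\<theta> m \<noteq> \<theta> a"
      using insert.prems(1) insert.hyps(2) that by (auto simp: inj_on_def)
    ultimately show ?thesis by simp
  qed
  then have "v a = 0"
    using * by simp
  then show ?case
    using zero insert.prems(4) by auto
qed

lemma component_sum_eigenspaces_inter:
  assumes lin: "Vector_Spaces.linear scale scale T"
    and fin: "finite I" and inj: "inj_on \<theta> I"
    and D: "\<And>m. m \<in> I \<Longrightarrow> D m = eigenspace scale T (\<theta> m)"
    and sub: "S \<subseteq> I" "S' \<subseteq> I"
  shows "component_sum D S \<inter> component_sum D S' \<subseteq> component_sum D (S \<inter> S')"
proof
  fix v assume "v \<in> component_sum D S \<inter> component_sum D S'"
  then obtain u w where u: "v = (\<Sum>m\<in>S. u m)" "\<And>m. m \<in> S \<Longrightarrow> u m \<in> D m"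
    and w: "v = (\<Sum>m\<in>S'. w m)" "\<And>m. m \<in> S' \<Longrightarrow> w m \<in> D m"
    by (metis IntE component_sumE)
  define u' where "u' m = (if m \<in> S then u m else 0)" for m
  define w' where "w' m = (if m \<in> S' then w m else 0)" for m
  have sums: "(\<Sum>m\<in>I. u' m) = v" "(\<Sum>m\<in>I. w' m) = v"
    using u(1) w(1) sub
    by (simp_all add: u'_def w'_def sum.inter_restrict[OF fin, symmetric] Int_absorb1)
  have eq: "u' m - w' m = 0" if "m \<in> I" for m
  proof (rule eigenvectors_independent[OF lin fin inj _ _ that])
    show "(\<Sum>m\<in>I. u' m - w' m) = 0"
      by (simp add: sum_subtractf sums)
    show "u' k - w' k \<in> eigenspace scale T (\<theta> k)" if k: "k \<in> I" for k
    proof (rule subspace_diff[OF subspace_eigenspace[OF lin]])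
      show "u' k \<in> eigenspace scale T (\<theta> k)" "w' k \<in> eigenspace scale T (\<theta> k)"
        using u(2)[of k] w(2)[of k] D[OF k] subspace_0[OF subspace_eigenspace[OF lin]]
        by (auto simp: u'_def w'_def)
    qed
  qed
  have "v = (\<Sum>m\<in>S \<inter> S'. u m)"
    unfolding u(1)
  proof (rule sum.mono_neutral_right)
    show "finite S" using fin sub(1) by (rule rev_finite_subset)
    show "\<forall>m\<in>S - S \<inter> S'. u m = 0"
    proof
      fix m assume m: "m \<in> S - S \<inter> S'"
      then have "m \<in> I" using sub by auto
      from eq[OF this] m show "u m = 0" by (simp add: u'_def w'_def)
    qed
  qed auto
  then show "v \<in> component_sum D (S \<inter> S')"
    using u(2) by (auto intro!: component_sumI)
qed

lemma diagonalizable_component_sum_eq_UNIV: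
  assumes lin: "Vector_Spaces.linear scale scale T"
    and diag: "diagonalizable scale T"
    and fin: "finite I" and eigs: "eigenvalues scale T \<subseteq> \<theta> ` I"
  shows "component_sum (\<lambda>m. eigenspace scale T (\<theta> m)) I = UNIV"
proof -
  let ?D = "\<lambda>m. eigenspace scale T (\<theta> m)"
  obtain B where B: "independent B" "span B = UNIV" "\<And>b. b \<in> B \<Longrightarrow> \<exists>c. T b = scale c b"
    using diag unfolding diagonalizable_def by blast
  have "b \<in> component_sum ?D I" if b: "b \<in> B" for b
  proof -
    obtain c where c: "T b = scale c b" using B(3) b by blast
    have "b \<noteq> 0" using B(1) b dependent_zero by blast
    then have "c \<in> \<theta> ` I" using c eigs unfolding eigenvalues_def by blast
    then obtain k where k: "k \<in> I" "c = \<theta> k" by blast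
    then have "b \<in> component_sum ?D {k}"
      using c by (simp add: eigenspace_def)
    then show ?thesis
      using component_sum_mono[OF fin, of "{k}" ?D] k(1) subspace_0 subspace_eigenspace[OF lin]
      by blast
  qed
  then have "span B \<subseteq> component_sum ?D I"
    using subspace_component_sum subspace_eigenspace[OF lin] by (intro span_minimal) auto
  then show ?thesis using B(2) by auto
qed

text \<open>
  Expand \<open>v\<close> into eigenvectors: \<open>T - \<theta> a\<close> multiplies the part for \<open>\<theta> m\<close> by \<open>\<theta> m - \<theta> a\<close>, so it
  can only kill the part with \<open>m = a\<close>.
\<close>

lemma component_sum_eigenspaces_insertI:
  assumes lin: "Vector_Spaces.linear scale scale T"
    and fin: "finite I" and inj: "inj_on \<theta> I"
    and full: "component_sum (\<lambda>m. eigenspace scale T (\<theta> m)) I = UNIV"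
    and S: "S \<subseteq> I" "a \<in> I"
    and v: "T v - scale (\<theta> a) v \<in> component_sum (\<lambda>m. eigenspace scale T (\<theta> m)) S"
  shows "v \<in> component_sum (\<lambda>m. eigenspace scale T (\<theta> m)) (insert a S)"
proof -
  interpret T: Vector_Spaces.linear scale scale T by fact
  obtain u where u: "T v - scale (\<theta> a) v = (\<Sum>m\<in>S. u m)"
    "\<And>m. m \<in> S \<Longrightarrow> u m \<in> eigenspace scale T (\<theta> m)"
    using v by (elim component_sumE) blast
  obtain w where w: "v = (\<Sum>m\<in>I. w m)" "\<And>m. m \<in> I \<Longrightarrow> w m \<in> eigenspace scale T (\<theta> m)"
    using full by (metis UNIV_I component_sumE)
  define u' where "u' m = (if m \<in> S then u m else 0)" for m
  have u'_sum: "(\<Sum>m\<in>I. u' m) = T v - scale (\<theta> a) v"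
    using u(1) S(1) by (simp add: u'_def sum.inter_restrict[OF fin, symmetric] Int_absorb1)
  have Tw: "T (w m) = scale (\<theta> m) (w m)" if "m \<in> I" for m
    using w(2)[OF that] by (simp add: eigenspace_def)
  have "T v - scale (\<theta> a) v = (\<Sum>m\<in>I. scale (\<theta> m - \<theta> a) (w m))"
    unfolding w(1)
    by (simp add: T.sum Tw scale_sum_right scale_left_diff_distrib sum_subtractf)
  then have sum0: "(\<Sum>m\<in>I. scale (\<theta> m - \<theta> a) (w m) - u' m) = 0"
    by (simp add: sum_subtractf u'_sum)
  have eq: "scale (\<theta> m - \<theta> a) (w m) - u' m = 0" if "m \<in> I" for m
  proof (rule eigenvectors_independent[OF lin fin inj _ sum0 that])
    show "scale (\<theta> k - \<theta> a) (w k) - u' k \<in> eigenspace scale T (\<theta> k)" if "k \<in> I" for k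
      using that u(2) w(2) subspace_eigenspace[OF lin]
      by (auto simp: u'_def intro!: subspace_diff subspace_0 subspace_scale)
  qed
  have "v = (\<Sum>m\<in>insert a S. w m)"
    unfolding w(1)
  proof (rule sum.mono_neutral_right[OF fin])
    show "insert a S \<subseteq> I" using S by simp
    show "\<forall>m\<in>I - insert a S. w m = 0"
    proof
      fix m assume m: "m \<in> I - insert a S"
      then have "\<theta> m \<noteq> \<theta> a" using inj S(2) by (auto simp: inj_on_def)
      then show "w m = 0" using eq[of m] m by (simp add: u'_def)
    qed
  qed
  then show ?thesis
    using w(2) S by (auto intro!: component_sumI)
qed

section \<open>Two operators satisfying the \<open>q\<close>-Weyl relation\<close>

lemma q_weyl_shifts_eigenvector:
  assumes linA: "Vector_Spaces.linear scale scale A"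
    and "q \<noteq> 0" "c \<noteq> 0"
    and weyl: "\<And>v. scale q (A (B v)) - scale (inverse q) (B (A v)) = scale (q - inverse q) v"
    and linB: "Vector_Spaces.linear scale scale B"
    and v: "v \<in> eigenspace scale A c"
  shows "B v - scale (inverse c) v \<in> eigenspace scale A (q powi (-2) * c)"
proof -
  interpret A: Vector_Spaces.linear scale scale A by fact
  interpret B: Vector_Spaces.linear scale scale B by fact
  have Av: "A v = scale c v" using v by (simp add: eigenspace_def)
  have "scale q (A (B v)) = scale (q - inverse q) v + scale (inverse q * c) (B v)"
    using weyl[of v] by (simp add: Av B.scale diff_eq_eq)
  then have "scale (inverse q) (scale q (A (B v)))
      = scale (inverse q) (scale (q - inverse q) v + scale (inverse q * c) (B v))"
    by simp
  then have "A (B v) = scale (1 - q powi (-2)) v + scale (q powi (-2) * c) (B v)"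
    using \<open>q \<noteq> 0\<close>
    by (simp add: scale_right_distrib right_diff_distrib power_int_minus power2_eq_square mult.assoc)
  then show ?thesis
    using \<open>c \<noteq> 0\<close>
    by (simp add: eigenspace_def A.diff A.scale Av scale_right_diff_distrib scale_left_diff_distrib
        mult.assoc)
qed

text \<open>
  By induction on \<open>n\<close>: the shift of an eigenvector lies one step down in the partial sums, and the
  shift of a vector from the bottom component is an eigenvector for the value
  \<open>q powi (- int d - 2)\<close>, hence zero.
\<close>

lemma q_weyl_partial_sums_subset:
  assumes lin: "Vector_Spaces.linear scale scale A" "Vector_Spaces.linear scale scale B"
    and q: "q \<noteq> 0"
    and weyl: "\<And>v. scale q (A (B v)) - scale (inverse q) (B (A v)) = scale (q - inverse q) v"
    and bottom: "eigenspace scale A (q powi (- int d - 2)) = {0}"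
    and inj: "inj_on (\<lambda>m. q powi (int d - 2 * int m)) {..d}"
    and full: "component_sum (\<lambda>m. eigenspace scale B (q powi (int d - 2 * int m))) {..d} = UNIV"
    and n: "n \<le> d"
  shows "component_sum (\<lambda>m. eigenspace scale A (q powi (2 * int m - int d))) {..n}
           \<subseteq> component_sum (\<lambda>m. eigenspace scale B (q powi (int d - 2 * int m))) {..n}"
proof -
  let ?U = "\<lambda>m. eigenspace scale A (q powi (2 * int m - int d))"
  let ?W = "\<lambda>m. eigenspace scale B (q powi (int d - 2 * int m))"
  have sub: "subspace (component_sum ?W S)" for S
    using subspace_component_sum subspace_eigenspace[OF lin(2)] by auto
  have shift: "B v - scale (q powi (int d - 2 * int m)) v
      \<in> eigenspace scale A (q powi (2 * int m - int d - 2))" if "v \<in> ?U m" for v m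
  proof -
    have "inverse (q powi (2 * int m - int d)) = q powi (int d - 2 * int m)"
      by (simp flip: power_int_minus)
    moreover have "q powi (-2) * q powi (2 * int m - int d) = q powi (2 * int m - int d - 2)"
      using q by (simp add: power_int_add[symmetric])
    ultimately show ?thesis
      using q_weyl_shifts_eigenvector[OF lin(1) q _ weyl lin(2) that] q by simp
  qed
  have comp: "?U m \<subseteq> component_sum ?W {..m}" if "m \<le> d" for m
    using that
  proof (induction m)
    case 0
    show ?case
    proof
      fix v assume v: "v \<in> ?U 0"
      have "B v - scale (q powi (int d - 2 * int 0)) v \<in> component_sum ?W {}"
        using shift[OF v] bottom by simp
      from component_sum_eigenspaces_insertI[OF lin(2) _ inj full _ _ this]
      show "v \<in> component_sum ?W {..0}" by simp
    qed
  next
    case (Suc m)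
    show ?case
    proof
      fix v assume v: "v \<in> ?U (Suc m)"
      have "2 * int (Suc m) - int d - 2 = 2 * int m - int d" by simp
      with shift[OF v] Suc
      have "B v - scale (q powi (int d - 2 * int (Suc m))) v \<in> component_sum ?W {..m}"
        by auto
      from component_sum_eigenspaces_insertI[OF lin(2) _ inj full _ _ this]
      show "v \<in> component_sum ?W {..Suc m}"
        using Suc.prems by (simp add: atMost_Suc)
    qed
  qed
  show ?thesis
  proof
    fix v assume "v \<in> component_sum ?U {..n}"
    then obtain u where u: "v = (\<Sum>m\<le>n. u m)" "\<And>m. m \<le> n \<Longrightarrow> u m \<in> ?U m"
      by (auto elim: component_sumE)
    have "u m \<in> component_sum ?W {..n}" if "m \<le> n" for m
    proof -
      have "component_sum ?W {..m} \<subseteq> component_sum ?W {..n}"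
        using that subspace_eigenspace[OF lin(2)] by (intro component_sum_mono subspace_0) auto
      then show ?thesis using comp[of m] u(2)[OF that] that n by auto
    qed
    then show "v \<in> component_sum ?W {..n}"
      unfolding u(1) by (intro subspace_sum sub) auto
  qed
qed

end

section \<open>Decompositions and flags of a module of type 1\<close>

lemma not_root_of_unity_powi_inject:
  fixes q :: "'f::field"
  assumes "q \<noteq> 0" "\<forall>n::nat. n \<ge> 1 \<longrightarrow> q ^ n \<noteq> 1" "q powi a = q powi b"
  shows "a = b"
proof -
  have *: "a' = b'" if "q powi a' = q powi b'" "a' \<le> b'" for a' b'
  proof (rule ccontr)
    assume "a' \<noteq> b'"
    with that(2) have "nat (b' - a') \<ge> 1" by simp
    have "q powi (b' - a') = 1"
      using that(1) assms(1) by (simp add: power_int_diff)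
    moreover have "q powi (b' - a') = q ^ nat (b' - a')"
      using that(2) by (simp add: power_int_def)
    ultimately show False
      using assms(2) \<open>nat (b' - a') \<ge> 1\<close> by auto
  qed
  show ?thesis
    using *[of a b] *[of b a] assms(3) by (cases "a \<le> b") auto
qed

lemma mod4_cases:
  fixes k :: 4
  obtains "k = 0" | "k = 1" | "k = 2" | "k = 3"
proof (cases k)
  case (of_int z)
  then have "z = 0 \<or> z = 1 \<or> z = 2 \<or> z = 3" by auto
  then show ?thesis using of_int that by auto
qed

lemma std_gen_cases:
  assumes "i \<noteq> j"
  obtains "std_gen i j" | "std_gen j i" "\<not> std_gen i j"
proof -
  have "i - j = - (j - i)" by simp
  then show ?thesis
    using that assms by (cases "j - i" rule: mod4_cases) (auto simp: std_gen_def)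
qed

lemma std_gen_add: "std_gen (i + k) (j + k) \<longleftrightarrow> std_gen i j"
  by (simp add: std_gen_def)

locale type_one_module = vector_space scale
  for scale :: "'f::field \<Rightarrow> 'v::ab_group_add \<Rightarrow> 'v" +
  fixes q :: 'f and x :: "4 \<Rightarrow> 4 \<Rightarrow> 'v \<Rightarrow> 'v" and d :: nat
  assumes q_nonzero: "q \<noteq> 0"
    and q_not_root: "\<forall>n::nat. n \<ge> 1 \<longrightarrow> q ^ n \<noteq> 1"
    and tet: "tet_module scale q x"
    and fin_dim: "finite_dim scale"
    and diameter: "has_diameter_type scale q x d 1"
begin

abbreviation decomp where "decomp \<equiv> tet_decomp scale q x d"
abbreviation flag where "flag \<equiv> tet_flag scale q x d"

lemma powi_inject: "q powi a = q powi b \<longleftrightarrow> a = b"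
  using not_root_of_unity_powi_inject[OF q_nonzero q_not_root] by auto

lemma linear_gen: "std_gen i j \<Longrightarrow> Vector_Spaces.linear scale scale (x i j)"
  using tet unfolding tet_module_def by blast

lemma eigenvalues_gen:
  "std_gen i j \<Longrightarrow> eigenvalues scale (x i j) = {q powi (int d - 2 * int n) | n. n \<le> d}"
  using diameter unfolding has_diameter_type_def by simp

lemma component_sum_gen_eq_UNIV:
  assumes "std_gen i j"
  shows "component_sum (\<lambda>m. eigenspace scale (x i j) (q powi (int d - 2 * int m))) {..d} = UNIV"
proof (rule diagonalizable_component_sum_eq_UNIV)
  show "Vector_Spaces.linear scale scale (x i j)" using linear_gen assms .
  show "diagonalizable scale (x i j)"
    using diameter assms unfolding has_diameter_type_def by blast
qed (auto simp: eigenvalues_gen[OF assms])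

lemma component_sum_gen_rev_eq_UNIV:
  assumes "std_gen i j"
  shows "component_sum (\<lambda>m. eigenspace scale (x i j) (q powi (2 * int m - int d))) {..d} = UNIV"
proof (rule diagonalizable_component_sum_eq_UNIV)
  show "Vector_Spaces.linear scale scale (x i j)" using linear_gen assms .
  show "diagonalizable scale (x i j)"
    using diameter assms unfolding has_diameter_type_def by blast
  show "eigenvalues scale (x i j) \<subseteq> (\<lambda>m. q powi (2 * int m - int d)) ` {..d}"
  proof
    fix c assume "c \<in> eigenvalues scale (x i j)"
    then obtain n where "n \<le> d" "c = q powi (int d - 2 * int n)"
      by (auto simp: eigenvalues_gen[OF assms])
    then have "d - n \<in> {..d}" "c = q powi (2 * int (d - n) - int d)"
      by (auto simp: of_nat_diff algebra_simps)
    then show "c \<in> (\<lambda>m. q powi (2 * int m - int d)) ` {..d}" by blast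
  qed
qed simp

lemma eigenspace_gen_trivial:
  assumes "std_gen i j" "\<And>n. n \<le> d \<Longrightarrow> a \<noteq> int d - 2 * int n"
  shows "eigenspace scale (x i j) (q powi a) = {0}"
proof -
  have "q powi a \<notin> eigenvalues scale (x i j)"
    using assms by (auto simp: eigenvalues_gen powi_inject)
  moreover have "0 \<in> eigenspace scale (x i j) (q powi a)"
    using subspace_eigenspace[OF linear_gen[OF assms(1)]] subspace_0 by blast
  ultimately show ?thesis
    unfolding eigenvalues_def eigenspace_def by blast
qed

lemma decomp_std: "std_gen i j \<Longrightarrow> decomp i j n = eigenspace scale (x i j) (q powi (int d - 2 * int n))"
  by (simp add: tet_decomp_def)

text \<open>
  If \<open>j - i = 2\<close> then \<open>[j,i]\<close> is defined through \<open>x j i\<close>, not as the inversion of \<open>[i,j]\<close>; but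
  \<open>x j i\<close> is the inverse of \<open>x i j\<close>, so the inverted eigenvalues belong to the same eigenspaces.
\<close>

lemma decomp_opposite:
  assumes gen: "std_gen i j" and n: "n \<le> d"
  shows "decomp j i n = eigenspace scale (x i j) (q powi (2 * int n - int d))"
proof (cases "std_gen j i")
  case False
  have "int d - 2 * int (d - n) = 2 * int n - int d"
    using n by (simp add: of_nat_diff)
  then show ?thesis using False by (simp add: tet_decomp_def)
next
  case True
  have diff2: "j - i = 2" "i - j = 2"
  proof -
    have "j - i \<noteq> 1"
    proof
      assume "j - i = 1"
      then have "i - j = - 1" by (metis minus_diff_eq)
      with True show False by (simp add: std_gen_def)
    qed
    then show "j - i = 2" using gen by (simp add: std_gen_def)
    then have "i - j = - 2" by (metis minus_diff_eq)
    then show "i - j = 2" by simp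
  qed
  have inv: "x i j (x j i v) = v" "x j i (x i j v) = v" for v
    using tet diff2 unfolding tet_module_def by blast+
  interpret ij: Vector_Spaces.linear scale scale "x i j" using linear_gen gen .
  interpret ji: Vector_Spaces.linear scale scale "x j i" using linear_gen True .
  let ?c = "q powi (int d - 2 * int n)"
  have c: "?c \<noteq> 0" using q_nonzero by simp
  have inv_c: "q powi (2 * int n - int d) = inverse ?c"
    by (simp flip: power_int_minus)
  have "x j i v = scale ?c v \<longleftrightarrow> x i j v = scale (inverse ?c) v" for v
  proof
    assume "x j i v = scale ?c v"
    then have "v = scale ?c (x i j v)" by (metis inv(1) ij.scale)
    then have "scale (inverse ?c) v = scale (inverse ?c) (scale ?c (x i j v))" by simp
    then show "x i j v = scale (inverse ?c) v" using c by simp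
  next
    assume "x i j v = scale (inverse ?c) v"
    then have "v = scale (inverse ?c) (x j i v)" by (metis inv(2) ji.scale)
    then have "scale ?c v = scale ?c (scale (inverse ?c) (x j i v))" by simp
    then show "x j i v = scale ?c v" using c by simp
  qed
  then show ?thesis
    using True by (auto simp: decomp_std eigenspace_def inv_c)
qed

lemma decomp_reverse:
  assumes "i \<noteq> j" and n: "n \<le> d"
  shows "decomp j i n = decomp i j (d - n)"
  using \<open>i \<noteq> j\<close>
proof (cases rule: std_gen_cases)
  case 1
  have "int d - 2 * int (d - n) = 2 * int n - int d" using n by (simp add: of_nat_diff)
  then show ?thesis using 1 n by (simp add: decomp_opposite[OF 1] decomp_std[OF 1])
next
  case 2
  have "2 * int (d - n) - int d = int d - 2 * int n" using n by (simp add: of_nat_diff)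
  then show ?thesis using 2 n by (simp add: decomp_opposite[OF 2(1)] decomp_std[OF 2(1)])
qed

lemma decomp_eigenspaces:
  assumes "i \<noteq> j"
  obtains T \<theta> where "Vector_Spaces.linear scale scale T" "inj_on \<theta> {..d}"
    "\<And>m. m \<in> {..d} \<Longrightarrow> decomp i j m = eigenspace scale T (\<theta> m)"
  using assms
proof (cases rule: std_gen_cases)
  case 1
  show ?thesis
    by (rule that[of "x i j" "\<lambda>m. q powi (int d - 2 * int m)"])
      (auto simp: linear_gen 1 decomp_std inj_on_def powi_inject)
next
  case 2
  show ?thesis
    by (rule that[of "x j i" "\<lambda>m. q powi (2 * int m - int d)"])
      (auto simp: linear_gen 2 decomp_opposite inj_on_def powi_inject)
qed

lemma zero_in_decomp: "i \<noteq> j \<Longrightarrow> m \<le> d \<Longrightarrow> 0 \<in> decomp i j m"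
  by (metis decomp_eigenspaces atMost_iff subspace_0 subspace_eigenspace)

lemma component_sum_decomp_eq_UNIV:
  assumes "i \<noteq> j"
  shows "component_sum (decomp i j) {..d} = UNIV"
  using assms
proof (cases rule: std_gen_cases)
  case 1
  then show ?thesis
    using component_sum_gen_eq_UNIV[OF 1] by (simp add: decomp_std cong: component_sum_cong)
next
  case 2
  have "component_sum (decomp i j) {..d}
      = component_sum (\<lambda>m. eigenspace scale (x j i) (q powi (2 * int m - int d))) {..d}"
    using 2 by (intro component_sum_cong) (simp add: decomp_opposite)
  then show ?thesis using component_sum_gen_rev_eq_UNIV[OF 2(1)] by simp
qed

lemma gen_q_weyl:
  assumes "(j - i, k - j) \<in> {(1, 1), (1, 2), (2, 1)}"
  shows "scale q (x i j (x j k v)) - scale (inverse q) (x j k (x i j v)) = scale (q - inverse q) v"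
proof -
  have "q - inverse q \<noteq> 0"
  proof
    assume "q - inverse q = 0"
    then have "q ^ 2 = 1" using q_nonzero by (simp add: power2_eq_square field_simps)
    then show False using q_not_root[rule_format, of 2] by simp
  qed
  moreover have "scale (1 / (q - inverse q))
      (scale q (x i j (x j k v)) - scale (inverse q) (x j k (x i j v))) = v"
    using tet assms unfolding tet_module_def by blast
  then have "scale (q - inverse q) (scale (1 / (q - inverse q))
      (scale q (x i j (x j k v)) - scale (inverse q) (x j k (x i j v)))) = scale (q - inverse q) v"
    by (rule arg_cong)
  ultimately show ?thesis by (simp only: scale_scale) simp
qed

lemma flags_agree:
  assumes diffs: "(j - i, k - j) \<in> {(1, 1), (1, 2), (2, 1)}" and n: "n \<le> d"
  shows "component_sum (decomp j i) {..n} = component_sum (decomp j k) {..n}"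
proof -
  have gen: "std_gen i j" "std_gen j k" using diffs by (auto simp: std_gen_def)
  let ?U = "\<lambda>m. eigenspace scale (x i j) (q powi (2 * int m - int d))"
  let ?W = "\<lambda>m. eigenspace scale (x j k) (q powi (int d - 2 * int m))"
  have powi_inv: "inverse q powi a = q powi (- a)" for a
    by (simp add: power_int_inverse power_int_minus)
  have "component_sum ?U {..n} \<subseteq> component_sum ?W {..n}"
  proof (rule q_weyl_partial_sums_subset[OF linear_gen[OF gen(1)] linear_gen[OF gen(2)] q_nonzero
        gen_q_weyl[OF diffs] _ _ component_sum_gen_eq_UNIV[OF gen(2)] n])
    show "eigenspace scale (x i j) (q powi (- int d - 2)) = {0}"
      by (rule eigenspace_gen_trivial[OF gen(1)]) auto
  qed (auto simp: inj_on_def powi_inject)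
  (* The roles of the two generators are swapped and q is replaced by its inverse. *)
  moreover have "component_sum (\<lambda>m. eigenspace scale (x j k) (inverse q powi (2 * int m - int d))) {..n}
      \<subseteq> component_sum (\<lambda>m. eigenspace scale (x i j) (inverse q powi (int d - 2 * int m))) {..n}"
  proof (rule q_weyl_partial_sums_subset[OF linear_gen[OF gen(2)] linear_gen[OF gen(1)] _ _ _ _ _ n])
    show "inverse q \<noteq> 0" using q_nonzero by simp
    show "scale (inverse q) (x j k (x i j v)) - scale (inverse (inverse q)) (x i j (x j k v))
        = scale (inverse q - inverse (inverse q)) v" for v
      using arg_cong[OF gen_q_weyl[OF diffs, of v], of uminus] by (simp add: scale_left_diff_distrib)
    have "q powi (- (- int d - 2)) = q powi (int d + 2)" by (simp add: add.commute)
    then show "eigenspace scale (x j k) (inverse q powi (- int d - 2)) = {0}"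
      unfolding powi_inv using eigenspace_gen_trivial[OF gen(2), of "int d + 2"] by auto
    show "component_sum (\<lambda>m. eigenspace scale (x i j) (inverse q powi (int d - 2 * int m))) {..d} = UNIV"
      using component_sum_gen_rev_eq_UNIV[OF gen(1)] by (simp add: powi_inv)
  qed (auto simp: inj_on_def powi_inv powi_inject)
  ultimately have "component_sum ?U {..n} = component_sum ?W {..n}"
    by (simp add: powi_inv)
  moreover have "component_sum (decomp j i) {..n} = component_sum ?U {..n}"
    using n by (intro component_sum_cong) (simp add: decomp_opposite[OF gen(1)])
  moreover have "component_sum (decomp j k) {..n} = component_sum ?W {..n}"
    by (intro component_sum_cong) (simp add: decomp_std[OF gen(2)])
  ultimately show ?thesis by simp
qed

lemma flag_eq_component_sum: "flag i n = component_sum (decomp i (i + 1)) {..n}"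
  by (simp add: tet_flag_def component_sum_def Ball_def)

text \<open>
  The relations link \<open>[j,j+3]\<close> with both \<open>[j,j+1]\<close> and \<open>[j,j+2]\<close>, where \<open>j + 3 = j - 1\<close>.
\<close>

lemma component_sum_decomp_eq_flag:
  assumes "i \<noteq> j" and n: "n \<le> d"
  shows "component_sum (decomp i j) {..n} = flag i n"
proof -
  have *: "component_sum (decomp i (i + 3)) {..n} = component_sum (decomp i (i + 1)) {..n}"
    "component_sum (decomp i (i + 3)) {..n} = component_sum (decomp i (i + 2)) {..n}"
    by (rule flags_agree[OF _ n]; simp)+
  have "j = i + (j - i)" by simp
  then consider "j = i + 1" | "j = i + 2" | "j = i + 3"
    using assms(1) by (cases "j - i" rule: mod4_cases) auto
  then show ?thesis
    using * by cases (simp_all add: flag_eq_component_sum)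
qed

text \<open>
  Read from its end, \<open>[i,j]\<close> is \<open>[j,i]\<close>, so the components \<open>n, \<dots>, d\<close> of \<open>[i,j]\<close> add up to
  a component of the flag \<open>[j]\<close>; the sum is direct, and only the \<open>n\<close>th component is common to
  this part and to the components \<open>0, \<dots>, n\<close>.
\<close>

lemma decomp_eq_flag_inter:
  assumes "i \<noteq> j" and n: "n \<le> d"
  shows "decomp i j n = flag i n \<inter> flag j (d - n)"
proof -
  have img: "(\<lambda>m. d - m) ` {..d - n} = {n..d}"
  proof
    show "{n..d} \<subseteq> (\<lambda>m. d - m) ` {..d - n}"
    proof
      fix m assume "m \<in> {n..d}"
      then have "m = d - (d - m)" "d - m \<in> {..d - n}" by auto
      then show "m \<in> (\<lambda>m. d - m) ` {..d - n}" by (rule image_eqI)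
    qed
  qed (use n in auto)
  have "flag j (d - n) = component_sum (decomp j i) {..d - n}"
    using assms by (simp add: component_sum_decomp_eq_flag)
  also have "\<dots> = component_sum (\<lambda>m. decomp i j (d - m)) {..d - n}"
    using decomp_reverse[OF assms(1)] by (intro component_sum_cong) simp
  also have "\<dots> = component_sum (decomp i j) {n..d}"
    by (subst component_sum_reindex) (auto simp: img inj_on_def)
  finally have flag_j: "flag j (d - n) = component_sum (decomp i j) {n..d}" .
  have flag_i: "flag i n = component_sum (decomp i j) {..n}"
    using assms by (simp add: component_sum_decomp_eq_flag)
  obtain T \<theta> where T: "Vector_Spaces.linear scale scale T" "inj_on \<theta> {..d}"
    "\<And>m. m \<in> {..d} \<Longrightarrow> decomp i j m = eigenspace scale T (\<theta> m)"
    using decomp_eigenspaces[OF assms(1)] by blast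
  have "{..n} \<inter> {n..d} = {n}" using n by auto
  then have "flag i n \<inter> flag j (d - n) \<subseteq> decomp i j n"
    using component_sum_eigenspaces_inter[OF T(1) _ T(2,3), of "{..n}" "{n..d}"] n
    by (simp add: flag_i flag_j)
  moreover
  have "decomp i j n \<subseteq> component_sum (decomp i j) S" if "n \<in> S" "S \<subseteq> {..d}" for S
  proof -
    have "component_sum (decomp i j) {n} \<subseteq> component_sum (decomp i j) S"
      using that finite_subset[OF that(2)] zero_in_decomp[OF assms(1)]
      by (intro component_sum_mono) auto
    then show ?thesis by simp
  qed
  from this[of "{..n}"] this[of "{n..d}"]
  have "decomp i j n \<subseteq> flag i n \<inter> flag j (d - n)"
    using n by (simp add: flag_i flag_j)
  ultimately show ?thesis by blast
qed

section \<open>Exchangers\<close>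

lemma linear_surj_imp_bij:
  assumes lin: "Vector_Spaces.linear scale scale X" and surj: "surj X"
  shows "bij X"
proof -
  obtain B where B: "finite B" "span B = UNIV"
    using fin_dim unfolding finite_dim_def by blast
  obtain B' where B': "B' \<subseteq> B" "independent B'" "span B' = UNIV"
    using maximal_independent_subset[of B] B(2) span_minimal[OF _ subspace_span]
    by (metis top.extremum_uniqueI)
  interpret finite_dimensional_vector_space scale B'
    using B' B(1) finite_subset by unfold_locales auto
  show ?thesis
    using linear_surj_imp_inj[OF lin surj] surj by (simp add: bij_def)
qed

lemma exchanger_imp_sends_decomp:
  assumes ex: "exchanger scale x X" and "i \<noteq> j"
  shows "sends X d (decomp i j) (decomp (i + 2) (j + 2))"
proof -
  interpret X: Vector_Spaces.linear scale scale X using ex unfolding exchanger_def by blast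
  have bij: "bij X" using ex unfolding exchanger_def by blast
  have img: "X ` eigenspace scale (x i j) c = eigenspace scale (x (i + 2) (j + 2)) c"
    if "std_gen i j" for i j c
  proof -
    have comm: "x (i + 2) (j + 2) (X v) = X (x i j v)" for v
    proof -
      have "X \<circ> x i j \<circ> inv X = x (i + 2) (j + 2)" using ex that unfolding exchanger_def by blast
      then have "x (i + 2) (j + 2) (X v) = (X \<circ> x i j \<circ> inv X) (X v)" by simp
      then show ?thesis using bij by (simp add: bij_is_inj)
    qed
    have "v \<in> eigenspace scale (x i j) c \<longleftrightarrow> X v \<in> eigenspace scale (x (i + 2) (j + 2)) c" for v
      using bij by (simp add: eigenspace_def comm X.scale[symmetric] inj_eq bij_is_inj)
    then show ?thesis
      using bij_is_surj[OF bij] by (auto simp: image_iff) (metis surjD)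
  qed
  show ?thesis
    unfolding sends_def tet_decomp_def std_gen_add
    by (rule std_gen_cases[OF \<open>i \<noteq> j\<close>]) (simp_all add: img)
qed

lemma sends_decomp_imp_sends_flag:
  assumes lin: "Vector_Spaces.linear scale scale X"
    and sends: "sends X d (decomp i (i + 1)) (decomp (i + 2) (i + 1 + 2))"
  shows "sends X d (flag i) (flag (i + 2))"
proof -
  have "component_sum (\<lambda>m. X ` decomp i (i + 1) m) {..n} = component_sum (decomp (i + 2) (i + 2 + 1)) {..n}"
    if "n \<le> d" for n
    using sends that by (intro component_sum_cong) (simp add: sends_def add.commute add.left_commute)
  then show ?thesis
    by (simp add: sends_def flag_eq_component_sum linear_image_component_sum[OF lin])
qed

lemma sends_flag_imp_sends_decomp:
  assumes lin: "Vector_Spaces.linear scale scale X"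
    and sends: "\<And>i. sends X d (flag i) (flag (i + 2))" and "i \<noteq> j"
  shows "sends X d (decomp i j) (decomp (i + 2) (j + 2))"
proof -
  (* Only the top components of the flags are needed for X to be onto. *)
  have "flag k d = UNIV" for k
    using component_sum_decomp_eq_UNIV[of k "k + 1"] by (simp add: flag_eq_component_sum)
  then have "surj X"
    using sends[of 0] unfolding sends_def by auto
  then have "inj X" using linear_surj_imp_bij[OF lin] by (simp add: bij_def)
  show ?thesis
    unfolding sends_def
  proof (intro allI impI)
    fix n assume n: "n \<le> d"
    have "X ` decomp i j n = X ` flag i n \<inter> X ` flag j (d - n)"
      by (simp add: decomp_eq_flag_inter[OF \<open>i \<noteq> j\<close> n] image_Int[OF \<open>inj X\<close>])
    also have "\<dots> = flag (i + 2) n \<inter> flag (j + 2) (d - n)"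
      using sends n by (simp add: sends_def)
    also have "\<dots> = decomp (i + 2) (j + 2) n"
      using \<open>i \<noteq> j\<close> n by (simp add: decomp_eq_flag_inter)
    finally show "X ` decomp i j n = decomp (i + 2) (j + 2) n" .
  qed
qed

lemma sends_decomp_imp_exchanger:
  assumes lin: "Vector_Spaces.linear scale scale X"
    and sends: "\<And>i j. i \<noteq> j \<Longrightarrow> sends X d (decomp i j) (decomp (i + 2) (j + 2))"
  shows "exchanger scale x X"
proof -
  interpret X: Vector_Spaces.linear scale scale X by fact
  have "X ` UNIV = X ` component_sum (decomp 0 1) {..d}"
    by (simp add: component_sum_decomp_eq_UNIV)
  also have "\<dots> = component_sum (\<lambda>m. X ` decomp 0 1 m) {..d}"
    by (rule linear_image_component_sum[OF lin])
  also have "\<dots> = component_sum (decomp (0 + 2) (1 + 2)) {..d}"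
    using sends[of 0 1] by (intro component_sum_cong) (simp add: sends_def)
  also have "\<dots> = UNIV"
    by (rule component_sum_decomp_eq_UNIV) simp
  finally have bij: "bij X" by (rule linear_surj_imp_bij[OF lin])
  have "X \<circ> x i j \<circ> inv X = x (i + 2) (j + 2)" if gen: "std_gen i j" for i j
  proof -
    have gen': "std_gen (i + 2) (j + 2)" using gen by (simp add: std_gen_add)
    interpret x: Vector_Spaces.linear scale scale "x i j" using linear_gen gen .
    interpret x': Vector_Spaces.linear scale scale "x (i + 2) (j + 2)" using linear_gen gen' .
    have "i \<noteq> j" using gen by (auto simp: std_gen_def)
    (* Both sides act on a component of the decomposition as the same scalar. *)
    have on_comp: "X (x i j v) = x (i + 2) (j + 2) (X v)" if v: "v \<in> decomp i j m" "m \<le> d" for v m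
    proof -
      have "X v \<in> decomp (i + 2) (j + 2) m"
        using sends[OF \<open>i \<noteq> j\<close>] v unfolding sends_def by blast
      then show ?thesis
        using v(1) by (simp add: decomp_std gen gen' eigenspace_def X.scale)
    qed
    have comm: "X (x i j v) = x (i + 2) (j + 2) (X v)" for v
    proof -
      obtain u where u: "v = (\<Sum>m\<le>d. u m)" "\<And>m. m \<in> {..d} \<Longrightarrow> u m \<in> decomp i j m"
        using component_sum_decomp_eq_UNIV[OF \<open>i \<noteq> j\<close>] by (metis UNIV_I component_sumE)
      then show ?thesis
        using on_comp by (auto simp: x.sum x'.sum X.sum intro!: sum.cong)
    qed
    show ?thesis
      using bij by (auto simp: fun_eq_iff comm surj_f_inv_f bij_is_surj)
  qed
  then show ?thesis
    unfolding exchanger_def using lin bij by blast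
qed

end

theorem lemma15p6:
  fixes scale :: "'f::alg_closed_field \<Rightarrow> 'v::ab_group_add \<Rightarrow> 'v"
    and q :: 'f
    and x :: "4 \<Rightarrow> 4 \<Rightarrow> 'v \<Rightarrow> 'v"
    and d :: nat
    and X :: "'v \<Rightarrow> 'v"
  assumes "q \<noteq> 0"
    and "\<forall>n::nat. n \<ge> 1 \<longrightarrow> q ^ n \<noteq> 1"
    and "evaluation_module scale q x d"
    and "Vector_Spaces.linear scale scale X"
  shows "(exchanger scale x X \<longleftrightarrow>
            (\<forall>i. sends X d (tet_flag scale q x d i) (tet_flag scale q x d (i + 2)))) \<and>
         ((\<forall>i. sends X d (tet_flag scale q x d i) (tet_flag scale q x d (i + 2))) \<longleftrightarrow>
            (\<forall>i j. i \<noteq> j \<longrightarrow>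
               sends X d (tet_decomp scale q x d i j) (tet_decomp scale q x d (i + 2) (j + 2))))"
proof -
  interpret vector_space scale
    using assms(3) unfolding evaluation_module_def tet_module_def by blast
  interpret type_one_module scale q x d
    using assms(1-3) unfolding evaluation_module_def by unfold_locales blast+
  have "exchanger scale x X \<Longrightarrow> \<forall>i j. i \<noteq> j \<longrightarrow> sends X d (decomp i j) (decomp (i + 2) (j + 2))"
    using exchanger_imp_sends_decomp by blast
  moreover have "\<forall>i j. i \<noteq> j \<longrightarrow> sends X d (decomp i j) (decomp (i + 2) (j + 2))
      \<Longrightarrow> exchanger scale x X"
    using sends_decomp_imp_exchanger[OF assms(4)] by blast
  moreover have "\<forall>i. sends X d (flag i) (flag (i + 2))"
    if "\<forall>i j. i \<noteq> j \<longrightarrow> sends X d (decomp i j) (decomp (i + 2) (j + 2))"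
  proof
    fix i :: 4
    have "i \<noteq> i + 1" by simp
    then show "sends X d (flag i) (flag (i + 2))"
      using sends_decomp_imp_sends_flag[OF assms(4)] that by blast
  qed
  moreover have "\<forall>i. sends X d (flag i) (flag (i + 2))
      \<Longrightarrow> \<forall>i j. i \<noteq> j \<longrightarrow> sends X d (decomp i j) (decomp (i + 2) (j + 2))"
    using sends_flag_imp_sends_decomp[OF assms(4)] by blast
  ultimately show ?thesis by blast
qed

end
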